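(* Let $(G,p)$ be an infinite bar-joint framework in $\mathbb{R}^d$ with spatial symmetry group $\mathcal{G}$ and with rigidity matrix transformation $R(G,p):\mathcal{H}_v\to\mathcal{H}_e$. Then $$R(G,p)=\rho_e(g^{-1})\,R(G,p)\,\hat\rho_v(g),\qquad g\in\mathcal{G}.$$
   Context: An infinite bar-joint framework $(G,p)$ in $\mathbb{R}^d$ consists of a countably infinite connected simple graph $G=(V,E)$ in which every vertex has finite degree, and a vector $p=(p_v)_{v\in V}$ of framework points in $\mathbb{R}^d$. $\mathcal{H}_v=\prod_V\mathbb{R}^d$ and $\mathcal{H}_e=\prod_E\mathbb{R}$ are the vector spaces of all families $(u_v)_{v\in V}$, $u_v\in\mathbb{R}^d$, and $(w_e)_{e\in E}$, $w_e\in\mathbb{R}$, respectively. The rigidity matrix has rows labelled by edges and columns labelled by vertices ($d$ columns per vertex): the row of the edge $e=(v,w)$ has $p_v-p_w$ in the columns of $v$, $p_w-p_v$ in the columns of $w$ and zeros elsewhere. It defines the linear transformation $R(G,p):\mathcal{H}_v\to\mathcal{H}_e$, $(R(G,p)u)_e=\langle p_v-p_w,u_v-u_w\rangle$ for $e=(v,w)$. The spatial symmetry group $\mathcal{G}$ is the group of $g=(\sigma,T)$ where $\sigma$ is an automorphism of $G$ and $T$ is an isometry of $\mathbb{R}^d$ with $p_{\sigma(v)}=Tp_v$ for all $v\in V$. For $g=(\sigma,T)\in\mathcal{G}$ with $S\in O(d)$ the linear part of $T$, the representations are $(\rho_e(g)w)_{\sigma(f)}=w_f$ on $\mathcal{H}_e$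 and $(\hat\rho_v(g)u)_{\sigma(v)}=Su_v$ on $\mathcal{H}_v$. *)

theory Defs
  imports "HOL-Analysis.Analysis" "HOL-Algebra.Bij"
begin

text \<open>An edge of a simple graph is a two-element set of vertices.\<close>

locale infinite_framework_graph =
  fixes V :: "'v set" and E :: "'v set set"
  assumes infinite_vertices: "infinite V"
    and countable_vertices: "countable V"
    and simple: "\<And>e. e \<in> E \<Longrightarrow> e \<subseteq> V \<and> card e = 2"
    and locally_finite: "\<And>v. v \<in> V \<Longrightarrow> finite {e \<in> E. v \<in> e}"
    and connected: "\<And>v w. v \<in> V \<Longrightarrow> w \<in> V \<Longrightarrow> (v, w) \<in> {(x, y). {x, y} \<in> E}\<^sup>*"

text \<open>Families indexed by \<open>V\<close> or \<open>E\<close> are extensional functions, and operators between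
  spaces of families are extensional on their domain, so that equality of HOL functions is
  equality of families and of operators respectively.\<close>

definition vertex_space :: "'v set \<Rightarrow> ('v \<Rightarrow> real ^ 'd) set" where
  "vertex_space V = (\<Pi>\<^sub>E v\<in>V. UNIV)"

definition edge_space :: "'v set set \<Rightarrow> ('v set \<Rightarrow> real) set" where
  "edge_space E = (\<Pi>\<^sub>E e\<in>E. UNIV)"

text \<open>The vector \<open>rigidity_matrix p e v\<close> collects the entries in row \<open>e\<close> and the columns
  of the vertex \<open>v\<close>.\<close>

definition rigidity_matrix :: "('v \<Rightarrow> real ^ 'd) \<Rightarrow> 'v set \<Rightarrow> 'v \<Rightarrow> real ^ 'd" where
  "rigidity_matrix p e v = (if v \<in> e then p v - p (THE w. e = {v, w}) else 0)"

text \<open>The product of row \<open>e\<close> with \<open>u\<close> only needs the columns of the two ends of \<open>e\<close>,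
  all other entries of the row being zero.\<close>

definition rigidity_map ::
  "'v set \<Rightarrow> 'v set set \<Rightarrow> ('v \<Rightarrow> real ^ 'd) \<Rightarrow> ('v \<Rightarrow> real ^ 'd) \<Rightarrow> 'v set \<Rightarrow> real" where
  "rigidity_map V E p =
    (\<lambda>u\<in>vertex_space V. \<lambda>e\<in>E. \<Sum>v\<in>e. rigidity_matrix p e v \<bullet> u v)"

definition graph_automorphisms :: "'v set \<Rightarrow> 'v set set \<Rightarrow> ('v \<Rightarrow> 'v) set" where
  "graph_automorphisms V E =
    {\<sigma> \<in> Bij V. \<forall>v\<in>V. \<forall>w\<in>V. {\<sigma> v, \<sigma> w} \<in> E \<longleftrightarrow> {v, w} \<in> E}"

definition isometry :: "(real ^ 'd \<Rightarrow> real ^ 'd) \<Rightarrow> bool" where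
  "isometry T \<longleftrightarrow> (\<forall>x y. dist (T x) (T y) = dist x y)"

definition linear_part :: "(real ^ 'd \<Rightarrow> real ^ 'd) \<Rightarrow> real ^ 'd \<Rightarrow> real ^ 'd" where
  "linear_part T x = T x - T 0"

definition spatial_symmetry_group ::
  "'v set \<Rightarrow> 'v set set \<Rightarrow> ('v \<Rightarrow> real ^ 'd) \<Rightarrow>
    (('v \<Rightarrow> 'v) \<times> (real ^ 'd \<Rightarrow> real ^ 'd)) monoid" where
  "spatial_symmetry_group V E p =
    (BijGroup V \<times>\<times> BijGroup UNIV)
      \<lparr>carrier := {(\<sigma>, T). \<sigma> \<in> graph_automorphisms V E \<and> isometry T \<and>
                           (\<forall>v\<in>V. p (\<sigma> v) = T (p v))}\<rparr>"

text \<open>A vertex permutation \<open>\<sigma>\<close> sends the edge \<open>f\<close> to \<open>\<sigma> ` f\<close>.\<close>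

definition edge_rep ::
  "'v set set \<Rightarrow> ('v \<Rightarrow> 'v) \<times> (real ^ 'd \<Rightarrow> real ^ 'd) \<Rightarrow>
    ('v set \<Rightarrow> real) \<Rightarrow> 'v set \<Rightarrow> real" where
  "edge_rep E = (\<lambda>(\<sigma>, T). \<lambda>w\<in>edge_space E. \<lambda>e\<in>E. w (inv_into E ((`) \<sigma>) e))"

definition vertex_rep ::
  "'v set \<Rightarrow> ('v \<Rightarrow> 'v) \<times> (real ^ 'd \<Rightarrow> real ^ 'd) \<Rightarrow>
    ('v \<Rightarrow> real ^ 'd) \<Rightarrow> 'v \<Rightarrow> real ^ 'd" where
  "vertex_rep V =
    (\<lambda>(\<sigma>, T). \<lambda>u\<in>vertex_space V. \<lambda>v\<in>V. linear_part T (u (inv_into V \<sigma> v)))"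

lemma isometry_linear_part:
  assumes "isometry T"
  shows "orthogonal_transformation (linear_part T)" "T x = linear_part T x + T 0"
  using assms
  by (auto simp: orthogonal_transformation_isometry isometry_def linear_part_def dist_norm)

lemma isometry_bij:
  assumes "isometry T"
  shows "bij T"
proof -
  have "T = (\<lambda>x. x + T 0) \<circ> linear_part T"
    by (auto simp: linear_part_def)
  moreover have "bij (linear_part T)"
    using isometry_linear_part(1)[OF assms] by (rule orthogonal_transformation_bij)
  moreover have "bij (\<lambda>x. x + T 0)"
    by (rule bij_plus_right)
  ultimately show ?thesis
    by (metis bij_comp)
qed

lemma rigidity_map_edge:
  assumes "u \<in> vertex_space V" "{v, w} \<in> E" "v \<noteq> w"
  shows "rigidity_map V E p u {v, w} = (p v - p w) \<bullet> (u v - u w)"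
proof -
  have "(THE x. {v, w} = {v, x}) = w" "(THE x. {v, w} = {w, x}) = v"
    using assms(3) by (auto intro!: the_equality simp: doubleton_eq_iff)
  then show ?thesis
    using assms by (simp add: rigidity_map_def rigidity_matrix_def inner_diff)
qed

lemma graph_automorphism_edges:
  assumes "infinite_framework_graph V E" "\<sigma> \<in> graph_automorphisms V E"
  shows "bij_betw ((`) \<sigma>) E E"
proof -
  interpret infinite_framework_graph V E by fact
  have b: "bij_betw \<sigma> V V" and s: "\<And>v w. v \<in> V \<Longrightarrow> w \<in> V \<Longrightarrow> {\<sigma> v, \<sigma> w} \<in> E \<longleftrightarrow> {v, w} \<in> E"
    using assms(2) by (auto simp: graph_automorphisms_def Bij_def)
  have inj: "inj_on ((`) \<sigma>) E"
    by (rule inj_onI) (metis b bij_betw_def inj_on_image_eq_iff simple)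
  have "\<sigma> ` e \<in> E" if "e \<in> E" for e
    using simple[OF that] s that by (auto simp: card_2_iff)
  moreover have "e \<in> (`) \<sigma> ` E" if e: "e \<in> E" for e
  proof -
    obtain x y where xy: "e = {x, y}" "x \<in> V" "y \<in> V"
      using simple[OF e] by (auto simp: card_2_iff)
    then obtain v w where "x = \<sigma> v" "y = \<sigma> w" "v \<in> V" "w \<in> V"
      using b by (metis bij_betw_imp_surj_on imageE)
    then show ?thesis
      using s xy e by (intro image_eqI[of _ _ "{v, w}"]) auto
  qed
  ultimately show ?thesis
    using inj by (auto simp: bij_betw_def)
qed

lemma edge_rep_apply:
  assumes "infinite_framework_graph V E" "(\<sigma>, T) \<in> carrier (spatial_symmetry_group V E p)"
    "w \<in> edge_space E" "f \<in> E"
  shows "edge_rep E (\<sigma>, T) w (\<sigma> ` f) = w f"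
proof -
  have "bij_betw ((`) \<sigma>) E E"
    using assms by (auto simp: spatial_symmetry_group_def intro: graph_automorphism_edges)
  then have "\<sigma> ` f \<in> E" "inv_into E ((`) \<sigma>) (\<sigma> ` f) = f"
    using assms(4) by (auto simp: bij_betw_def)
  then show ?thesis
    using assms by (simp add: edge_rep_def)
qed

lemma vertex_rep_apply:
  assumes "(\<sigma>, T) \<in> carrier (spatial_symmetry_group V E p)" "u \<in> vertex_space V" "v \<in> V"
  shows "vertex_rep V (\<sigma>, T) u (\<sigma> v) = linear_part T (u v)"
proof -
  have "bij_betw \<sigma> V V"
    using assms by (auto simp: spatial_symmetry_group_def graph_automorphisms_def Bij_def)
  then show ?thesis
    using assms by (auto simp: vertex_rep_def bij_betw_def)
qed

lemma group_spatial_symmetry_group: "group (spatial_symmetry_group V E p)"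
proof -
  let ?P = "BijGroup V \<times>\<times> BijGroup (UNIV :: (real ^ 'd) set)"
  let ?C = "{(\<sigma>, T). \<sigma> \<in> graph_automorphisms V E \<and> isometry T \<and> (\<forall>v\<in>V. p (\<sigma> v) = T (p v))}"
  interpret P: group ?P
    by (intro DirProd_group group_BijGroup)
  have "subgroup ?C ?P"
  proof (rule P.subgroupI)
    show sub: "?C \<subseteq> carrier ?P"
      by (auto simp: graph_automorphisms_def BijGroup_def Bij_def isometry_bij)
    show "?C \<noteq> {}"
    proof -
      have "((\<lambda>v\<in>V. v), id) \<in> ?C"
        by (auto simp: graph_automorphisms_def isometry_def id_Bij)
      then show ?thesis by blast
    qed
    fix g assume g: "g \<in> ?C"
    obtain \<sigma> T where gd: "g = (\<sigma>, T)" by fastforce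
    have B: "\<sigma> \<in> Bij V" "T \<in> Bij UNIV"
      using g sub by (auto simp: gd BijGroup_def graph_automorphisms_def Bij_def isometry_bij)
    have cV: "carrier (BijGroup V) = Bij V"
      and cU: "carrier (BijGroup (UNIV :: (real ^ 'd) set)) = Bij UNIV"
      by (simp_all add: BijGroup_def)
    have i: "inv\<^bsub>?P\<^esub> g = (\<lambda>v\<in>V. inv_into V \<sigma> v, inv_into UNIV T)"
      using B by (simp add: gd inv_DirProd group_BijGroup cV cU inv_BijGroup restrict_def)
    have bs: "bij_betw \<sigma> V V" "bij T" using B by (auto simp: Bij_def)
    have r: "\<And>v. v \<in> V \<Longrightarrow> \<sigma> (inv_into V \<sigma> v) = v" "\<And>v. v \<in> V \<Longrightarrow> inv_into V \<sigma> v \<in> V"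
      using bs(1) by (auto simp: bij_betw_def f_inv_into_f inv_into_into)
    have t: "T (inv_into UNIV T x) = x" "inv_into UNIV T (T x) = x" for x
      using bs(2) by (auto simp: bij_def surj_f_inv_f)
    have "isometry (inv_into UNIV T)"
      using g t by (simp add: gd isometry_def) (metis t(1))
    moreover have "p (inv_into V \<sigma> v) = inv_into UNIV T (p v)" if "v \<in> V" for v
    proof -
      have "p (\<sigma> (inv_into V \<sigma> v)) = T (p (inv_into V \<sigma> v))"
        using g r(2)[OF that] by (auto simp: gd)
      then show ?thesis using t r(1)[OF that] by simp
    qed
    moreover have "(\<lambda>v\<in>V. inv_into V \<sigma> v) \<in> graph_automorphisms V E"
      unfolding graph_automorphisms_def
    proof (intro CollectI conjI ballI)
      show "(\<lambda>v\<in>V. inv_into V \<sigma> v) \<in> Bij V"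
        using B(1) by (rule restrict_inv_into_Bij)
      fix v w assume vw: "v \<in> V" "w \<in> V"
      have "{\<sigma> (inv_into V \<sigma> v), \<sigma> (inv_into V \<sigma> w)} \<in> E \<longleftrightarrow> {inv_into V \<sigma> v, inv_into V \<sigma> w} \<in> E"
        using g r(2) vw by (auto simp: gd graph_automorphisms_def)
      then show "{(\<lambda>v\<in>V. inv_into V \<sigma> v) v, (\<lambda>v\<in>V. inv_into V \<sigma> v) w} \<in> E \<longleftrightarrow> {v, w} \<in> E"
        using r(1) vw by simp
    qed
    ultimately show "inv\<^bsub>?P\<^esub> g \<in> ?C"
      by (auto simp: i)
    fix h assume h: "h \<in> ?C"
    obtain \<tau> U where hd: "h = (\<tau>, U)" by fastforce
    have B': "\<tau> \<in> Bij V" "U \<in> Bij UNIV"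
      using h by (auto simp: hd graph_automorphisms_def Bij_def isometry_bij)
    have m: "\<sigma> \<otimes>\<^bsub>BijGroup V\<^esub> \<tau> = compose V \<sigma> \<tau>" "T \<otimes>\<^bsub>BijGroup UNIV\<^esub> U = compose UNIV T U"
      using B B' by (simp_all add: BijGroup_def)
    have tv: "\<And>v. v \<in> V \<Longrightarrow> \<tau> v \<in> V"
      using B'(1) by (auto simp: Bij_def bij_betw_def)
    show "g \<otimes>\<^bsub>?P\<^esub> h \<in> ?C"
      using g h B B' tv
      by (simp add: m gd hd graph_automorphisms_def isometry_def compose_eq compose_Bij)
  qed
  then show ?thesis
    unfolding spatial_symmetry_group_def by (rule P.subgroup_imp_group)
qed

end

theory Submission
  imports Defs
begin

text \<open>
  Multiplied by \<open>\<rho>\<^sub>e(g)\<close>, the identity says that \<open>R(G,p)\<close> intertwines the two representations of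
  \<open>g = (\<sigma>, T)\<close>. In the row of the image edge \<open>{\<sigma> v, \<sigma> w}\<close> the bar is
  \<open>p (\<sigma> v) - p (\<sigma> w) = T (p v) - T (p w) = S (p v - p w)\<close>, with \<open>S\<close> the linear part of \<open>T\<close>, and
  \<open>g\<close> turns the velocity difference of \<open>u\<close> along \<open>{v, w}\<close> by the same \<open>S\<close>. Since \<open>S\<close> preserves
  inner products, the entry there equals the entry of \<open>R(G,p) u\<close> in the row \<open>{v, w}\<close>
  (\<open>rigidity_map_symmetry\<close>). The operator \<open>\<rho>\<^sub>e(g\<inverse>)\<close> moves this entry back to \<open>{v, w}\<close>, because
  the vertex permutation of \<open>g\<inverse>\<close> undoes \<open>\<sigma>\<close> (\<open>inv_symmetry_vertex\<close>).
\<close>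

lemma symmetry_graph_automorphism:
  assumes "(\<sigma>, T) \<in> carrier (spatial_symmetry_group V E p)"
  shows "\<sigma> \<in> graph_automorphisms V E" "\<sigma> \<in> Bij V"
  using assms by (auto simp: spatial_symmetry_group_def graph_automorphisms_def)

lemma vertex_rep_closed:
  assumes "u \<in> vertex_space V"
  shows "vertex_rep V g u \<in> vertex_space V"
  using assms by (cases g) (simp add: vertex_rep_def vertex_space_def)

lemma rigidity_map_closed:
  assumes "u \<in> vertex_space V"
  shows "rigidity_map V E p u \<in> edge_space E"
  using assms by (simp add: rigidity_map_def edge_space_def)

text \<open>The inverse is taken abstractly in the group, so its action on vertices is read off from the
  first component of the group law \<open>g\<inverse> g = 1\<close>.\<close>

lemma inv_symmetry_vertex:
  assumes g: "(\<sigma>, T) \<in> carrier (spatial_symmetry_group V E p)"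
    and inv: "inv\<^bsub>spatial_symmetry_group V E p\<^esub> (\<sigma>, T) = (\<tau>, U)"
    and v: "v \<in> V"
  shows "\<tau> (\<sigma> v) = v"
proof -
  let ?G = "spatial_symmetry_group V E p"
  interpret group ?G
    by (rule group_spatial_symmetry_group)
  have "(\<tau>, U) \<in> carrier ?G"
    using g inv inv_closed by metis
  then have "\<tau> \<in> Bij V" "\<sigma> \<in> Bij V"
    using g symmetry_graph_automorphism(2) by blast+
  then have "fst ((\<tau>, U) \<otimes>\<^bsub>?G\<^esub> (\<sigma>, T)) = compose V \<tau> \<sigma>"
    by (simp add: spatial_symmetry_group_def DirProd_def BijGroup_def)
  moreover have "(\<tau>, U) \<otimes>\<^bsub>?G\<^esub> (\<sigma>, T) = \<one>\<^bsub>?G\<^esub>"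
    using g inv l_inv by metis
  moreover have "fst \<one>\<^bsub>?G\<^esub> = (\<lambda>v\<in>V. v)"
    by (simp add: spatial_symmetry_group_def DirProd_def BijGroup_def)
  ultimately have "compose V \<tau> \<sigma> v = (\<lambda>v\<in>V. v) v"
    by simp
  then show ?thesis
    using v by (simp add: compose_eq)
qed

text \<open>The intertwining relation, one row at a time: a bar and the relative velocity of its ends are
  both turned by the orthogonal map \<open>linear_part T\<close>, which leaves their inner product unchanged.\<close>

lemma rigidity_map_symmetry:
  assumes fw: "infinite_framework_graph V E"
    and g: "(\<sigma>, T) \<in> carrier (spatial_symmetry_group V E p)"
    and u: "u \<in> vertex_space V"
    and f: "f \<in> E"
  shows "rigidity_map V E p (vertex_rep V (\<sigma>, T) u) (\<sigma> ` f) = rigidity_map V E p u f"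
proof -
  let ?S = "linear_part T"
  interpret infinite_framework_graph V E by fact
  have T: "isometry T" and p\<sigma>: "\<And>v. v \<in> V \<Longrightarrow> p (\<sigma> v) = T (p v)"
    using g by (auto simp: spatial_symmetry_group_def)
  have S: "orthogonal_transformation ?S"
    using T by (rule isometry_linear_part(1))
  obtain v w where vw: "f = {v, w}" "v \<noteq> w" "v \<in> V" "w \<in> V"
    using simple[OF f] by (auto simp: card_2_iff)
  have \<sigma>E: "{\<sigma> v, \<sigma> w} \<in> E"
    using symmetry_graph_automorphism(1)[OF g] f vw by (simp add: graph_automorphisms_def)
  then have \<sigma>vw: "\<sigma> v \<noteq> \<sigma> w"
    using simple by fastforce
  have S_diff: "?S a - ?S b = ?S (a - b)" for a b
    using S by (simp add: orthogonal_transformation_def linear_diff)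
  have bar: "p (\<sigma> v) - p (\<sigma> w) = ?S (p v - p w)"
    using vw p\<sigma> S_diff[of "p v" "p w"] by (simp add: linear_part_def)
  have "rigidity_map V E p (vertex_rep V (\<sigma>, T) u) (\<sigma> ` f) = ?S (p v - p w) \<bullet> ?S (u v - u w)"
    using rigidity_map_edge[OF vertex_rep_closed[OF u] \<sigma>E \<sigma>vw] vw
    by (simp add: bar S_diff vertex_rep_apply[OF g u])
  also have "\<dots> = (p v - p w) \<bullet> (u v - u w)"
    using S by (simp add: orthogonal_transformation_def)
  also have "\<dots> = rigidity_map V E p u f"
    using rigidity_map_edge[OF u] f vw by simp
  finally show ?thesis .
qed

theorem theorem4p6:
  fixes V :: "'v set" and E :: "'v set set" and p :: "'v \<Rightarrow> real ^ 'd"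
    and g :: "('v \<Rightarrow> 'v) \<times> (real ^ 'd \<Rightarrow> real ^ 'd)"
  assumes "infinite_framework_graph V E"
    and "g \<in> carrier (spatial_symmetry_group V E p)"
  shows "rigidity_map V E p =
    compose (vertex_space V) (edge_rep E (inv\<^bsub>spatial_symmetry_group V E p\<^esub> g))
      (compose (vertex_space V) (rigidity_map V E p) (vertex_rep V g))"
proof -
  let ?G = "spatial_symmetry_group V E p"
  obtain \<sigma> T where gd: "g = (\<sigma>, T)" by fastforce
  obtain \<tau> U where inv: "inv\<^bsub>?G\<^esub> g = (\<tau>, U)" by fastforce
  have g: "(\<sigma>, T) \<in> carrier ?G"
    using assms(2) gd by simp
  have h: "(\<tau>, U) \<in> carrier ?G"
    using group.inv_closed[OF group_spatial_symmetry_group assms(2)] inv by simp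
  have rows: "edge_rep E (\<tau>, U) (rigidity_map V E p (vertex_rep V g u)) f = rigidity_map V E p u f"
    if u: "u \<in> vertex_space V" and f: "f \<in> E" for u f
  proof -
    have "f \<subseteq> V"
      using infinite_framework_graph.simple[OF assms(1) f] by simp
    then have undo: "\<tau> ` \<sigma> ` f = f"
      using inv_symmetry_vertex[OF g inv[unfolded gd]] by (force simp: image_iff)
    have "\<sigma> ` f \<in> E"
      using graph_automorphism_edges[OF assms(1) symmetry_graph_automorphism(1)[OF g]] f
      by (auto simp: bij_betw_def)
    then have "edge_rep E (\<tau>, U) (rigidity_map V E p (vertex_rep V g u)) (\<tau> ` \<sigma> ` f) =
        rigidity_map V E p (vertex_rep V g u) (\<sigma> ` f)"
      by (intro edge_rep_apply[OF assms(1) h] rigidity_map_closed vertex_rep_closed u)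
    then show ?thesis
      using rigidity_map_symmetry[OF assms(1) g u f] undo gd by simp
  qed
  \<comment> \<open>Both sides are extensional, as operators and as families, so agreement on the rows suffices.\<close>
  show ?thesis
  proof (rule extensionalityI)
    show "rigidity_map V E p \<in> extensional (vertex_space V)"
      by (simp add: rigidity_map_def)
    fix u :: "'v \<Rightarrow> real ^ 'd" assume u: "u \<in> vertex_space V"
    have Ru: "rigidity_map V E p (vertex_rep V g u) \<in> edge_space E"
      by (intro rigidity_map_closed vertex_rep_closed u)
    have "rigidity_map V E p u = edge_rep E (\<tau>, U) (rigidity_map V E p (vertex_rep V g u))"
    proof (rule extensionalityI)
      show "rigidity_map V E p u \<in> extensional E"
        using u by (simp add: rigidity_map_def)
      show "edge_rep E (\<tau>, U) (rigidity_map V E p (vertex_rep V g u)) \<in> extensional E"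
        using Ru by (simp add: edge_rep_def)
    qed (simp add: rows u)
    then show "rigidity_map V E p u = compose (vertex_space V) (edge_rep E (inv\<^bsub>?G\<^esub> g))
        (compose (vertex_space V) (rigidity_map V E p) (vertex_rep V g)) u"
      using u by (simp add: compose_eq inv)
  qed (rule compose_extensional)
qed

end
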